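(* Let $\mathbb K=\mathbb R$ or $\mathbb K=\mathbb C$, let $K\subseteq\mathbb K^n$ be compact and let $g\in C(K,\mathbb K)$. The following three assertions are equivalent: (1) $(\mathbf f,g)$ is reducible to the principal component of $U_n(C(K,\mathbb K))$ for every $\mathbf f\in C(K,\mathbb K^n)$ such that $(\mathbf f,g)\in U_{n+1}(C(K,\mathbb K))$; (2) for every $\mathbf f\in C(K,\mathbb K^n)$ with $Z(\mathbf f)\cap Z(g)=\emptyset$ there exist finitely many matrices $B_1,\dots,B_k\in\mathcal M_n(C(Z(g),\mathbb K))$ such that $$\mathbf f|_{Z(g)}=\mathbf e_1\cdot e^{B_1}\cdots e^{B_k};$$ (3) $Z(g)$ has no holes in $\mathbb K^n$.
   Context: For a compact space $Y$, $C(Y,\mathbb K)$ is the algebra of continuous $\mathbb K$-valued functions on $Y$ with the supremum norm, and $C(K,\mathbb K^n)=C(K,\mathbb K)^n$. $Z(g)=\{x\in K:g(x)=0\}$, and for $\mathbf f=(f_1,\dots,f_n)$, $Z(\mathbf f)=\bigcap_{j=1}^nZ(f_j)$. A hole of a compact set $L\subseteq\mathbb K^n$ is a bounded connected component of $\mathbb K^n\setminus L$. For a commutative unital Banach algebra $A$ over $\mathbb K$ with identity $\mathbf 1$: $U_n(A)$ is the set of tuples $(f_1,\dots,f_n)\in A^n$ for which there is $(x_1,\dots,x_n)\in A^n$ with $\sum_jx_jf_j=\mathbf 1$, with the topology induced by $A^n$; $\mathcal M_n(A)$ is the set of $n\times n$ matrices over $A$; $\mathbf e_1=(\mathbf 1,0,\dots,0)\in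 A^n$. The principal component of $U_n(A)$ is the connected component of $\mathbf e_1$ in $U_n(A)$, given by $\mathcal P(U_n(A))=\{\mathbf e_1e^{M_1}\cdots e^{M_k}:k\in\mathbb N,\ M_j\in\mathcal M_n(A)\}$. A tuple $(\mathbf f,g)\in U_{n+1}(A)$ with $\mathbf f\in A^n$ is reducible to the principal component of $U_n(A)$ if there is $\mathbf h\in A^n$ with $\mathbf f+g\,\mathbf h\in\mathcal P(U_n(A))$.
   Formalization: For K=R and n=1 the implication from (3) to (1),(2) is not claimed, since it is false there (K=[0,1], g=0, f=-1); for K=R it is asserted only for n≥2, while (1)⇔(2) and (2)⇒(3) are kept for all n. *)

theory Defs
  imports "HOL-Analysis.Analysis"
begin

section \<open>Algebras of continuous functions on a compact set\<close>

text \<open>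
  For a compact \<open>L\<close>, the functions of \<open>C(L, Y)\<close> are represented by their extensional
  representatives (\<open>undefined\<close> outside \<open>L\<close>), so that equality in \<open>C(L, Y)\<close> is equality in HOL;
  the metric of \<open>cfunspace\<close> is the supremum metric.  Tuples and matrices over \<open>C(L, \<bbbK>)\<close> are
  represented by vector-valued and matrix-valued functions, i.e. \<open>C(L, \<bbbK>)\<^sup>n = C(L, \<bbbK>\<^sup>n)\<close> and
  \<open>M\<^sub>n(C(L, \<bbbK>)) = C(L, M\<^sub>n(\<bbbK>))\<close>, with the (uniform) topology of the product.
\<close>

abbreviation C_metric :: "'x::topological_space set \<Rightarrow> ('x \<Rightarrow> 'b::metric_space) metric" where
  "C_metric L \<equiv> cfunspace (top_of_set L) euclidean_metric"

definition C_fun :: "'x::topological_space set \<Rightarrow> ('x \<Rightarrow> 'b::metric_space) set" where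
  "C_fun L = mspace (C_metric L)"

definition C_top :: "'x::topological_space set \<Rightarrow> ('x \<Rightarrow> 'b::metric_space) topology" where
  "C_top L = mtopology_of (C_metric L)"

lemma topspace_C_top [simp]: "topspace (C_top L) = C_fun L"
  by (simp add: C_top_def C_fun_def)

lemma C_fun_iff:
  assumes "compact L"
  shows "f \<in> C_fun L \<longleftrightarrow> f \<in> extensional L \<and> continuous_on L f"
  using compact_imp_bounded[OF compact_continuous_image[OF _ assms], of f]
  by (auto simp: C_fun_def)

definition zero_set :: "'x set \<Rightarrow> ('x \<Rightarrow> 'b::zero) \<Rightarrow> 'x set" where
  "zero_set L f = {x \<in> L. f x = 0}"

definition unimodular ::
  "'x::topological_space set \<Rightarrow> ('x \<Rightarrow> 'k::real_normed_field ^ 'm) set" where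
  "unimodular L = {f \<in> C_fun L. \<exists>u \<in> C_fun L. \<forall>x\<in>L. (\<Sum>j\<in>UNIV. u x $ j * f x $ j) = 1}"

text \<open>
  The tuple \<open>(f, g)\<close> of length \<open>n + 1\<close>, indexed by \<open>'n option\<close>.
\<close>

definition tuple_snoc ::
  "'x set \<Rightarrow> ('x \<Rightarrow> 'k ^ 'n) \<Rightarrow> ('x \<Rightarrow> 'k) \<Rightarrow> 'x \<Rightarrow> 'k ^ ('n option)" where
  "tuple_snoc L f g = (\<lambda>x\<in>L. \<chi> j. case j of None \<Rightarrow> g x | Some i \<Rightarrow> f x $ i)"

text \<open>
  A finite index type has no canonical first element, so the coordinate \<open>i\<close> in which
  \<open>e\<^sub>1 = (1, 0, \<dots>, 0)\<close> has its entry \<open>1\<close> is a parameter.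
\<close>

definition unit_tuple :: "'n \<Rightarrow> 'x set \<Rightarrow> 'x \<Rightarrow> 'k::real_normed_field ^ 'n" where
  "unit_tuple i L = (\<lambda>x\<in>L. axis i 1)"

definition principal_component ::
  "'n \<Rightarrow> 'x::topological_space set \<Rightarrow> ('x \<Rightarrow> 'k::real_normed_field ^ 'n) set" where
  "principal_component i L =
     connected_component_of_set (subtopology (C_top L) (unimodular L)) (unit_tuple i L)"

definition reducible_to_principal_component ::
  "'n \<Rightarrow> 'x::topological_space set \<Rightarrow> ('x \<Rightarrow> 'k::real_normed_field ^ 'n) \<Rightarrow> ('x \<Rightarrow> 'k) \<Rightarrow> bool" where
  "reducible_to_principal_component i L f g \<longleftrightarrow>
     (\<exists>h \<in> C_fun L. (\<lambda>x\<in>L. f x + g x *s h x) \<in> principal_component i L)"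


section \<open>Exponentials of matrices\<close>

definition mat_power :: "'k::real_normed_field ^ 'n ^ 'n \<Rightarrow> nat \<Rightarrow> 'k ^ 'n ^ 'n" where
  "mat_power A m = ((\<lambda>X. A ** X) ^^ m) (mat 1)"

definition mat_exp :: "'k::real_normed_field ^ 'n ^ 'n \<Rightarrow> 'k ^ 'n ^ 'n" where
  "mat_exp A = (\<Sum>m. (1 / fact m) *\<^sub>R mat_power A m)"

text \<open>
  The exponential of \<open>B\<close> in the Banach algebra \<open>M\<^sub>n(C(L, \<bbbK>))\<close>. Lemma \<open>mat_fun_exp_limit\<close> below shows
  that it is the sum of the exponential series in the norm of that algebra.
\<close>

definition mat_fun_exp ::
  "'x set \<Rightarrow> ('x \<Rightarrow> 'k::real_normed_field ^ 'n ^ 'n) \<Rightarrow> 'x \<Rightarrow> 'k ^ 'n ^ 'n" where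
  "mat_fun_exp L B = (\<lambda>x\<in>L. mat_exp (B x))"

text \<open>The product \<open>exp B\<^sub>1 \<cdots> exp B\<^sub>k\<close>, in this order, for \<open>Bs = [B\<^sub>1, \<dots>, B\<^sub>k]\<close>.\<close>

definition mat_fun_exp_prod ::
  "'x set \<Rightarrow> ('x \<Rightarrow> 'k::real_normed_field ^ 'n ^ 'n) list \<Rightarrow> 'x \<Rightarrow> 'k ^ 'n ^ 'n" where
  "mat_fun_exp_prod L Bs = (\<lambda>x\<in>L. foldr (\<lambda>B P. mat_fun_exp L B x ** P) Bs (mat 1))"

definition tuple_mult ::
  "'x set \<Rightarrow> ('x \<Rightarrow> 'k::real_normed_field ^ 'n) \<Rightarrow> ('x \<Rightarrow> 'k ^ 'n ^ 'n) \<Rightarrow> 'x \<Rightarrow> 'k ^ 'n" where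
  "tuple_mult L f M = (\<lambda>x\<in>L. f x v* M x)"

lemma norm_vec_le_sum: "norm (x :: 'a::real_normed_vector ^ 'n) \<le> (\<Sum>i\<in>UNIV. norm (x $ i))"
  unfolding norm_vec_def by (rule L2_set_le_sum) simp

lemma norm_matrix_mult_le:
  fixes A B :: "'k::real_normed_field ^ 'n ^ 'n"
  shows "norm (A ** B) \<le> real CARD('n) ^ 3 * (norm A * norm B)"
proof -
  have entry: "norm (X $ i $ j) \<le> norm X" for X :: "'k ^ 'n ^ 'n" and i j
    by (rule order_trans[OF Finite_Cartesian_Product.norm_nth_le Finite_Cartesian_Product.norm_nth_le])
  have "norm ((A ** B) $ i $ j) \<le> real CARD('n) * (norm A * norm B)" for i j
  proof -
    have "norm ((A ** B) $ i $ j) = norm (\<Sum>l\<in>UNIV. A $ i $ l * B $ l $ j)"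
      by (simp add: matrix_matrix_mult_def)
    also have "\<dots> \<le> (\<Sum>l\<in>(UNIV :: 'n set). norm A * norm B)"
      by (rule sum_norm_le) (simp add: norm_mult mult_mono entry)
    finally have "norm ((A ** B) $ i $ j) \<le> (\<Sum>l\<in>(UNIV :: 'n set). norm A * norm B)" .
    then show ?thesis by simp
  qed
  then have "norm ((A ** B) $ i) \<le> (\<Sum>j\<in>(UNIV :: 'n set). real CARD('n) * (norm A * norm B))" for i
    by (blast intro: order_trans[OF norm_vec_le_sum] sum_mono)
  then have "norm (A ** B) \<le>
      (\<Sum>i\<in>(UNIV :: 'n set). \<Sum>j\<in>(UNIV :: 'n set). real CARD('n) * (norm A * norm B))"
    by (blast intro: order_trans[OF norm_vec_le_sum] sum_mono)
  then show ?thesis by (simp add: power3_eq_cube mult.assoc)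
qed

lemma norm_mat_power_le:
  fixes A :: "'k::real_normed_field ^ 'n ^ 'n"
  assumes "norm A \<le> R"
  shows "norm (mat_power A m) \<le> (real CARD('n) ^ 3 * R) ^ m * norm (mat 1 :: 'k ^ 'n ^ 'n)"
proof (induction m)
  case (Suc m)
  have "0 \<le> R" using assms norm_ge_zero order_trans by blast
  have "norm (mat_power A (Suc m)) \<le> real CARD('n) ^ 3 * (norm A * norm (mat_power A m))"
    by (simp add: mat_power_def norm_matrix_mult_le)
  also have "\<dots> \<le> real CARD('n) ^ 3 *
      (R * ((real CARD('n) ^ 3 * R) ^ m * norm (mat 1 :: 'k ^ 'n ^ 'n)))"
    using assms Suc \<open>0 \<le> R\<close> by (intro mult_left_mono mult_mono) auto
  finally show ?case by (simp add: mult_ac)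
qed (simp add: mat_power_def)

lemma continuous_on_matrix_mult:
  fixes F G :: "'x::topological_space \<Rightarrow> 'k::real_normed_field ^ 'n ^ 'n"
  assumes "continuous_on L F" "continuous_on L G"
  shows "continuous_on L (\<lambda>x. F x ** G x)"
  unfolding matrix_matrix_mult_def
  by (intro continuous_intros assms)

lemma mat_fun_exp_limit:
  fixes B :: "'x::topological_space \<Rightarrow> 'k::{real_normed_field, banach} ^ 'n ^ 'n"
  assumes L: "compact L" and B: "B \<in> C_fun L"
  shows "limitin (C_top L) (\<lambda>N. \<lambda>x\<in>L. \<Sum>m<N. (1 / fact m) *\<^sub>R mat_power (B x) m)
           (mat_fun_exp L B) sequentially"
proof -
  define S where "S = (\<lambda>N x. \<Sum>m<N. (1 / fact m) *\<^sub>R mat_power (B x) m)"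
  define c where "c = real CARD('n) ^ 3"
  have cB: "continuous_on L B" using B C_fun_iff[OF L] by blast
  obtain R where R: "\<And>x. x \<in> L \<Longrightarrow> norm (B x) \<le> R"
    using compact_imp_bounded[OF compact_continuous_image[OF cB L]]
    by (auto simp: bounded_iff)
  have "uniform_limit L S (\<lambda>x. \<Sum>m. (1 / fact m) *\<^sub>R mat_power (B x) m) sequentially"
    unfolding S_def
  proof (rule Weierstrass_m_test)
    fix m x assume "x \<in> L"
    have "norm ((1 / fact m) *\<^sub>R mat_power (B x) m)
        \<le> (1 / fact m) * ((c * R) ^ m * norm (mat 1 :: 'k ^ 'n ^ 'n))"
      unfolding norm_scaleR c_def using norm_mat_power_le[OF R[OF \<open>x \<in> L\<close>], of m]
      by (simp add: divide_right_mono)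
    then show "norm ((1 / fact m) *\<^sub>R mat_power (B x) m)
        \<le> (inverse (fact m) * (c * R) ^ m) * norm (mat 1 :: 'k ^ 'n ^ 'n)"
      by (simp add: field_simps)
  next
    show "summable (\<lambda>m. (inverse (fact m) * (c * R) ^ m) * norm (mat 1 :: 'k ^ 'n ^ 'n))"
      by (intro summable_mult2 summable_exp)
  qed
  then have lim: "uniform_limit L S (\<lambda>x. mat_exp (B x)) sequentially"
    by (simp add: mat_exp_def)
  have cP: "continuous_on L (\<lambda>x. mat_power (B x) m)" for m
    by (induction m) (simp_all add: mat_power_def continuous_on_matrix_mult cB)
  then have cS: "continuous_on L (S N)" for N
    unfolding S_def by (intro continuous_intros)
  have cE: "continuous_on L (\<lambda>x. mat_exp (B x))"
    by (rule uniform_limit_theorem[OF _ lim]) (simp_all add: cS)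
  have SC: "(\<lambda>x\<in>L. S N x) \<in> C_fun L" for N
    using cS by (simp add: C_fun_iff[OF L] cong: continuous_on_cong)
  have EC: "mat_fun_exp L B \<in> C_fun L"
    using cE by (simp add: C_fun_iff[OF L] mat_fun_exp_def cong: continuous_on_cong)
  have "\<forall>\<^sub>F N in sequentially. (\<lambda>x\<in>L. S N x) \<in> mspace (C_metric L) \<and>
      mdist (C_metric L) (\<lambda>x\<in>L. S N x) (mat_fun_exp L B) < e" if "e > 0" for e
  proof -
    have "\<forall>\<^sub>F N in sequentially. \<forall>x\<in>L. dist (S N x) (mat_exp (B x)) < e / 2"
      using lim that unfolding uniform_limit_iff by (meson half_gt_zero)
    then show ?thesis
    proof eventually_elim
      case (elim N)
      have "mdist (C_metric L) (\<lambda>x\<in>L. S N x) (mat_fun_exp L B) \<le> e / 2"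
        using elim that by (intro mdist_cfunspace_le) (auto simp: mat_fun_exp_def less_imp_le)
      then show ?case using SC[of N] that by (simp add: C_fun_def)
    qed
  qed
  then show ?thesis
    using EC unfolding C_top_def mtopology_of_def C_fun_def S_def
    by (simp only: Metric_space.limitin_metric[OF Metric_space_mspace_mdist]) blast
qed


section \<open>Holes\<close>

definition holes :: "'a::real_normed_vector set \<Rightarrow> 'a set set" where
  "holes L = {H \<in> components (- L). bounded H}"

end

theory Submission
  imports Defs
begin

text \<open>
  For compact \<open>L\<close> the unimodular tuples over \<open>L\<close> are the nowhere vanishing maps, and the orbit of
  \<open>e\<^sub>1\<close> under products of exponentials is open and closed among them; since exponents can be
  contracted to \<open>0\<close>, this orbit is the principal component, and it consists of the maps that are
  homotopic to \<open>e\<^sub>1\<close> in \<open>\<bbbK>\<^sup>n - {0}\<close>. Exponents extend from \<open>Z(g)\<close> to \<open>K\<close> by Dugundji's theorem,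
  which yields (2) \<open>\<Longrightarrow>\<close> (1) after an approximation. By Borsuk's separation theorem, \<open>Z(g)\<close> has no
  holes iff all maps from \<open>Z(g)\<close> to \<open>\<bbbK>\<^sup>n - {0}\<close> are null-homotopic.
\<close>

section \<open>Matrix exponentials\<close>

lemma mat_power_0 [simp]: "mat_power A 0 = mat 1"
  and mat_power_Suc [simp]: "mat_power A (Suc m) = A ** mat_power A m"
  by (simp_all add: mat_power_def)

lemma mat_power_add: "mat_power A (m + l) = mat_power A m ** mat_power A l"
  by (induction m) (simp_all add: matrix_mul_assoc)

lemma matrix_mult_scaleR_right:
  "(A :: 'k::real_normed_field ^ 'n ^ 'm) ** (c *\<^sub>R B) = c *\<^sub>R (A ** B)"
  by (simp add: matrix_matrix_mult_def vec_eq_iff scaleR_sum_right)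

lemma matrix_mult_uminus_left:
  "(- A :: 'k::real_normed_field ^ 'n ^ 'm) ** B = - (A ** B)"
  by (simp add: matrix_matrix_mult_def vec_eq_iff sum_negf)

lemma mat_power_uminus: "mat_power (- A) m = (- 1) ^ m *\<^sub>R mat_power A m"
  by (induction m) (simp_all add: matrix_mult_scaleR_right matrix_mult_uminus_left)

text \<open>The bound \<open>norm_mat_power_le\<close> carries a factor \<open>CARD('n) ^ 3\<close>
  per multiplication, so the majorant is the exponential series of \<open>?c\<close> rather than of
  \<open>norm A\<close>.\<close>

lemma mat_exp_summable:
  fixes A :: "'k::real_normed_field ^ 'n ^ 'n"
  shows "summable (\<lambda>m. norm ((1 / fact m) *\<^sub>R mat_power A m))"
proof (rule summable_comparison_test')
  let ?c = "real CARD('n) ^ 3 * norm A"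
  show "summable (\<lambda>m. inverse (fact m) * ?c ^ m * norm (mat 1 :: 'k ^ 'n ^ 'n))"
    by (intro summable_mult2 summable_exp)
  show "norm (norm ((1 / fact m) *\<^sub>R mat_power A m))
      \<le> inverse (fact m) * ?c ^ m * norm (mat 1 :: 'k ^ 'n ^ 'n)" if "m \<ge> 0" for m
    using norm_mat_power_le[of A "norm A" m]
    by (simp add: divide_inverse mult.assoc mult.left_commute[of _ "inverse (fact m)"] mult_left_mono)
qed

lemma norm_entry_le: "norm (A $ i $ j) \<le> norm (A :: 'a::real_normed_vector ^ 'n ^ 'm)"
  by (rule order_trans[OF Finite_Cartesian_Product.norm_nth_le Finite_Cartesian_Product.norm_nth_le])

lemma mat_exp_entry_summable:
  fixes A :: "'k::real_normed_field ^ 'n ^ 'n"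
  shows "summable (\<lambda>m. norm ((1 / fact m) *\<^sub>R mat_power A m $ i $ j))"
proof (rule summable_comparison_test'[OF mat_exp_summable])
  show "norm (norm ((1 / fact m) *\<^sub>R mat_power A m $ i $ j))
      \<le> norm ((1 / fact m) *\<^sub>R mat_power A m)" if "m \<ge> 0" for m
    using norm_entry_le[of "(1 / fact m) *\<^sub>R mat_power A m" i j] by simp
qed

lemma mat_exp_entry:
  fixes A :: "'k::{real_normed_field, banach} ^ 'n ^ 'n"
  shows "mat_exp A $ i $ j = (\<Sum>m. (1 / fact m) *\<^sub>R mat_power A m $ i $ j)"
proof -
  have "bounded_linear (\<lambda>M :: 'k ^ 'n ^ 'n. M $ i $ j)"
    by (rule bounded_linear_compose[OF bounded_linear_vec_nth bounded_linear_vec_nth])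
  from bounded_linear.suminf[OF this summable_norm_cancel[OF mat_exp_summable]]
  show ?thesis by (simp add: mat_exp_def)
qed

text \<open>Each entry of the product is a finite sum of Cauchy products of absolutely convergent
  series. By the binomial theorem the terms of total degree \<open>k\<close> add up to
  \<open>(1 + (- 1)) ^ k / fact k\<close> times an entry of \<open>mat_power A k\<close>, which
  vanishes unless \<open>k = 0\<close>.\<close>

lemma mat_exp_mult_uminus:
  fixes A :: "'k::{real_normed_field, banach} ^ 'n ^ 'n"
  shows "mat_exp A ** mat_exp (- A) = mat 1"
proof -
  have "(mat_exp A ** mat_exp (- A)) $ i $ j = mat 1 $ i $ j" for i j
  proof -
    define a where "a = (\<lambda>l m. (1 / fact m) *\<^sub>R mat_power A m $ i $ l)"
    define b where "b = (\<lambda>l m. (1 / fact m) *\<^sub>R mat_power (- A) m $ l $ j)"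
    have lhs: "(\<lambda>k. \<Sum>l\<in>UNIV. \<Sum>p\<le>k. a l p * b l (k - p)) sums
        (\<Sum>l\<in>UNIV. (\<Sum>m. a l m) * (\<Sum>m. b l m))"
      unfolding a_def b_def by (intro sums_sum Cauchy_product_sums mat_exp_entry_summable)
    have entry: "(\<Sum>l\<in>UNIV. (\<Sum>m. a l m) * (\<Sum>m. b l m)) = (mat_exp A ** mat_exp (- A)) $ i $ j"
      by (simp add: matrix_matrix_mult_def mat_exp_entry a_def b_def)
    have coeff: "(\<Sum>l\<in>UNIV. \<Sum>p\<le>k. a l p * b l (k - p)) = (if k = 0 then mat 1 $ i $ j else 0)" for k
    proof -
      have "(\<Sum>l\<in>UNIV. \<Sum>p\<le>k. a l p * b l (k - p)) = (\<Sum>p\<le>k. \<Sum>l\<in>UNIV. a l p * b l (k - p))"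
        by (rule sum.swap)
      also have "\<dots> = (\<Sum>p\<le>k. (of_nat (k choose p) * 1 ^ p * (- 1) ^ (k - p) / fact k) *\<^sub>R mat_power A k $ i $ j)"
      proof (rule sum.cong)
        fix p assume "p \<in> {..k}"
        then have p: "p \<le> k" by simp
        have "(\<Sum>l\<in>UNIV. a l p * b l (k - p)) =
            (1 / fact p * (1 / fact (k - p)) * (- 1) ^ (k - p)) *\<^sub>R
            (\<Sum>l\<in>UNIV. mat_power A p $ i $ l * mat_power A (k - p) $ l $ j)"
          by (simp add: a_def b_def mat_power_uminus scaleR_sum_right) (simp add: mult.commute)
        also have "(\<Sum>l\<in>UNIV. mat_power A p $ i $ l * mat_power A (k - p) $ l $ j) = mat_power A k $ i $ j"
          using mat_power_add[of A p "k - p"] p by (simp add: matrix_matrix_mult_def)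
        also have "1 / fact p * (1 / fact (k - p)) * (- 1) ^ (k - p) =
            (of_nat (k choose p) * 1 ^ p * (- 1) ^ (k - p) / fact k :: real)"
          by (simp add: binomial_fact[OF p] field_simps)
        finally show "(\<Sum>l\<in>UNIV. a l p * b l (k - p)) =
            (of_nat (k choose p) * 1 ^ p * (- 1) ^ (k - p) / fact k) *\<^sub>R mat_power A k $ i $ j" .
      qed simp
      also have "\<dots> = ((1 + (- 1)) ^ k / fact k) *\<^sub>R mat_power A k $ i $ j"
        by (simp only: binomial_ring scaleR_sum_left sum_divide_distrib)
      finally show ?thesis by (simp add: power_0_left)
    qed
    have "(\<lambda>k. if k = 0 then mat 1 $ i $ j else 0 :: 'k) sums (mat 1 $ i $ j)"
      using sums_single[of 0 "\<lambda>_. mat 1 $ i $ j :: 'k"] by simp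
    then have "(\<lambda>k. \<Sum>l\<in>UNIV. \<Sum>p\<le>k. a l p * b l (k - p)) sums (mat 1 $ i $ j)"
      unfolding coeff .
    from sums_unique2[OF lhs this] entry show ?thesis by simp
  qed
  then show ?thesis by (simp add: vec_eq_iff)
qed

lemma mat_exp_mat:
  fixes c :: "'k::{real_normed_field, banach}"
  shows "mat_exp (mat c :: 'k ^ 'n ^ 'n) = mat (exp c)"
proof -
  have "mat_power (mat c :: 'k ^ 'n ^ 'n) m = mat (c ^ m)" for m
  proof (induction m)
    case (Suc m)
    then show ?case
      by (simp add: matrix_matrix_mult_def mat_def vec_eq_iff if_distrib[of "\<lambda>z. z * _"]
          cong: if_cong)
  qed simp
  then have "mat_exp (mat c :: 'k ^ 'n ^ 'n) $ i $ j = mat (exp c) $ i $ j" for i j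
    by (cases "i = j") (simp_all add: mat_exp_entry mat_def exp_def divide_inverse)
  then show ?thesis by (simp add: vec_eq_iff)
qed

text \<open>Serves the nilpotent factor in \<open>exp_orbit_step\<close> and, with
  \<open>N = 0\<close>, the start of the contraction in \<open>exp_orbit_homotopic\<close>.\<close>

lemma mat_exp_square_zero:
  fixes N :: "'k::{real_normed_field, banach} ^ 'n ^ 'n"
  assumes "N ** N = 0"
  shows "mat_exp N = mat 1 + N"
proof -
  have "mat_power N (Suc (Suc m)) = 0" for m
    using assms by (simp add: matrix_mul_assoc)
  then have "mat_power N m = 0" if "m \<notin> {0, 1}" for m
    using that by (metis One_nat_def insertCI old.nat.exhaust)
  then have "mat_exp N = (\<Sum>m\<in>{0, 1}. (1 / fact m) *\<^sub>R mat_power N m)"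
    unfolding mat_exp_def by (intro suminf_finite) simp_all
  then show ?thesis by simp
qed

text \<open>A limit in \<open>C_top L\<close> lies in its topspace, so convergence of the
  exponential series in the norm of the algebra already contains continuity.\<close>

lemma continuous_on_mat_exp:
  fixes B :: "'x::topological_space \<Rightarrow> 'k::{real_normed_field, banach} ^ 'n ^ 'n"
  assumes L: "compact L" and B: "continuous_on L B"
  shows "continuous_on L (\<lambda>x. mat_exp (B x))"
proof -
  have "restrict B L \<in> C_fun L"
    using B by (simp add: C_fun_iff[OF L])
  from limitin_topspace[OF mat_fun_exp_limit[OF L this]]
  show ?thesis
    by (simp add: C_fun_iff[OF L] mat_fun_exp_def)
qed

section \<open>Products of exponentials and the orbit of e_1\<close>

definition exp_prod ::
  "('x \<Rightarrow> 'k::real_normed_field ^ 'n ^ 'n) list \<Rightarrow> 'x \<Rightarrow> 'k ^ 'n ^ 'n" where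
  "exp_prod Bs x = foldr (\<lambda>B P. mat_exp (B x) ** P) Bs (mat 1)"

lemma exp_prod_Nil [simp]: "exp_prod [] x = mat 1"
  and exp_prod_Cons [simp]: "exp_prod (B # Bs) x = mat_exp (B x) ** exp_prod Bs x"
  by (simp_all add: exp_prod_def)

lemma exp_prod_append: "exp_prod (Bs @ Cs) x = exp_prod Bs x ** exp_prod Cs x"
  by (induction Bs) (simp_all add: matrix_mul_assoc)

text \<open>\<open>exp_prod\<close> has no domain attached, which permits induction on the list and
  evaluation over changing domains; this leads back to the product over \<open>L\<close>.\<close>

lemma mat_fun_exp_prod_eq: "x \<in> L \<Longrightarrow> mat_fun_exp_prod L Bs x = exp_prod Bs x"
  by (simp add: mat_fun_exp_prod_def exp_prod_def mat_fun_exp_def)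

text \<open>The points \<open>x\<close> and \<open>y\<close> may have different types: besides
  restricted and extended exponents, this covers exponents on \<open>{0..1} \<times> L\<close>
  evaluated at \<open>y = (1, x)\<close>.\<close>

lemma exp_prod_cong:
  "(\<And>B. B \<in> set Bs \<Longrightarrow> F B y = B x) \<Longrightarrow> exp_prod (map F Bs) y = exp_prod Bs x"
  by (induction Bs) auto

lemma continuous_on_exp_prod:
  fixes Bs :: "('x::topological_space \<Rightarrow> 'k::{real_normed_field, banach} ^ 'n ^ 'n) list"
  assumes "compact L" "\<And>B. B \<in> set Bs \<Longrightarrow> continuous_on L B"
  shows "continuous_on L (exp_prod Bs)"
  using assms(2)
proof (induction Bs)
  case Nil
  then show ?case by (simp add: exp_prod_def)
next
  case (Cons B Bs)
  have "continuous_on L (\<lambda>x. mat_exp (B x) ** exp_prod Bs x)"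
    using Cons by (intro continuous_on_matrix_mult continuous_on_mat_exp[OF assms(1)]) auto
  then show ?case by (simp add: exp_prod_def)
qed

text \<open>Every factor is invertible, its inverse being the exponential of the negated
  exponent.\<close>

lemma vector_exp_prod_nonzero:
  fixes v :: "'k::{real_normed_field, banach} ^ 'n"
  assumes "v \<noteq> 0"
  shows "v v* exp_prod Bs x \<noteq> 0"
  using assms
proof (induction Bs arbitrary: v)
  case (Cons B Bs)
  have "v v* mat_exp (B x) v* mat_exp (- B x) = v"
    by (simp add: vector_matrix_mul_assoc mat_exp_mult_uminus)
  then have "v v* mat_exp (B x) \<noteq> 0"
    using Cons.prems by (metis vector_matrix_mult_0)
  then show ?case
    using Cons.IH by (simp add: vector_matrix_mul_assoc[symmetric])
qed simp

text \<open>Only the tuple has to be extensional. The exponents are merely continuous on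
  \<open>L\<close>, so that they can be scaled, extended and concatenated freely;
  \<open>exp_orbit_iff\<close> restores exponents in \<open>C_fun L\<close>.\<close>

definition exp_orbit ::
  "'n \<Rightarrow> 'x::topological_space set \<Rightarrow> ('x \<Rightarrow> 'k::real_normed_field ^ 'n) set" where
  "exp_orbit i L = {f \<in> extensional L. \<exists>Bs. (\<forall>B\<in>set Bs. continuous_on L B) \<and>
     (\<forall>x\<in>L. f x = axis i 1 v* exp_prod Bs x)}"

lemma exp_orbit_iff:
  assumes L: "compact L"
  shows "f \<in> exp_orbit i L \<longleftrightarrow>
    (\<exists>Bs. set Bs \<subseteq> C_fun L \<and> f = tuple_mult L (unit_tuple i L) (mat_fun_exp_prod L Bs))"
proof
  assume "f \<in> exp_orbit i L"
  then obtain Bs where f: "f \<in> extensional L" and c: "\<forall>B\<in>set Bs. continuous_on L B"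
    and eq: "\<And>x. x \<in> L \<Longrightarrow> f x = axis i 1 v* exp_prod Bs x"
    by (auto simp: exp_orbit_def)
  let ?Bs = "map (\<lambda>B. restrict B L) Bs"
  have "exp_prod ?Bs x = exp_prod Bs x" if "x \<in> L" for x
    by (rule exp_prod_cong) (simp add: that)
  then have "f = tuple_mult L (unit_tuple i L) (mat_fun_exp_prod L ?Bs)"
    using f by (intro extensionalityI[of _ L])
      (auto simp: tuple_mult_def unit_tuple_def mat_fun_exp_prod_eq eq)
  moreover have "set ?Bs \<subseteq> C_fun L"
    using c by (auto simp: C_fun_iff[OF L])
  ultimately show "\<exists>Bs. set Bs \<subseteq> C_fun L \<and> f = tuple_mult L (unit_tuple i L) (mat_fun_exp_prod L Bs)"
    by blast
next
  assume "\<exists>Bs. set Bs \<subseteq> C_fun L \<and> f = tuple_mult L (unit_tuple i L) (mat_fun_exp_prod L Bs)"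
  then obtain Bs where Bs: "set Bs \<subseteq> C_fun L"
    and f: "f = tuple_mult L (unit_tuple i L) (mat_fun_exp_prod L Bs)"
    by blast
  have "\<forall>B\<in>set Bs. continuous_on L B"
    using Bs by (auto simp: C_fun_iff[OF L])
  moreover have "f \<in> extensional L" "\<forall>x\<in>L. f x = axis i 1 v* exp_prod Bs x"
    by (simp_all add: f tuple_mult_def unit_tuple_def mat_fun_exp_prod_eq)
  ultimately show "f \<in> exp_orbit i L"
    by (auto simp: exp_orbit_def)
qed

lemma exp_orbit_nonzero:
  fixes f :: "'x::topological_space \<Rightarrow> 'k::{real_normed_field, banach} ^ 'n"
  assumes "f \<in> exp_orbit i L" "x \<in> L"
  shows "f x \<noteq> 0"
proof -
  obtain Bs where "f x = axis i 1 v* exp_prod Bs x"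
    using assms by (auto simp: exp_orbit_def)
  then show ?thesis
    using vector_exp_prod_nonzero[of "axis i (1 :: 'k)" Bs x] by (simp add: axis_eq_0_iff)
qed

lemma exp_orbit_subset_C_fun:
  fixes i :: "'n::finite" and L :: "'x::topological_space set"
  assumes L: "compact L"
  shows "exp_orbit i L \<subseteq> (C_fun L :: ('x \<Rightarrow> 'k::{real_normed_field, banach} ^ 'n) set)"
proof
  fix f :: "'x \<Rightarrow> 'k ^ 'n" assume "f \<in> exp_orbit i L"
  then obtain Bs where f: "f \<in> extensional L" and c: "\<forall>B\<in>set Bs. continuous_on L B"
    and eq: "\<And>x. x \<in> L \<Longrightarrow> f x = axis i 1 v* exp_prod Bs x"
    by (auto simp: exp_orbit_def)
  have "continuous_on L (exp_prod Bs)"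
    using c by (intro continuous_on_exp_prod L) blast
  then have "continuous_on L (\<lambda>x. axis i 1 v* exp_prod Bs x)"
    unfolding vector_matrix_mult_def by (intro continuous_intros)
  then have "continuous_on L f"
    by (rule continuous_on_eq) (simp add: eq)
  then show "f \<in> C_fun L"
    using f by (simp add: C_fun_iff[OF L])
qed

text \<open>Contract all exponents linearly to \<open>0\<close>.\<close>

lemma exp_orbit_homotopic:
  fixes f :: "'x::topological_space \<Rightarrow> 'k::{real_normed_field, banach} ^ 'n"
  assumes L: "compact L" and f: "f \<in> exp_orbit i L"
  shows "homotopic_with_canon (\<lambda>_. True) L (- {0}) (\<lambda>_. axis i 1) f"
proof -
  obtain Bs where c: "\<forall>B\<in>set Bs. continuous_on L B"
    and eq: "\<And>x. x \<in> L \<Longrightarrow> f x = axis i 1 v* exp_prod Bs x"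
    using f by (auto simp: exp_orbit_def)
  let ?Bs = "map (\<lambda>B y. fst y *\<^sub>R B (snd y)) Bs"
  let ?h = "\<lambda>y :: real \<times> 'x. axis i (1 :: 'k) v* exp_prod ?Bs y"
  have "continuous_on ({0..1} \<times> L) (\<lambda>y. fst y *\<^sub>R B (snd y))" if "B \<in> set Bs" for B
    by (rule continuous_on_scaleR[OF continuous_on_fst[OF continuous_on_id]
          continuous_on_compose2[OF _ continuous_on_snd[OF continuous_on_id]]])
      (use that c in auto)
  \<comment> \<open>Joint continuity in \<open>(t, x)\<close> comes from the general lemma, applied
    over the compact set \<open>{0..1} \<times> L\<close>.\<close>
  then have "continuous_on ({0..1} \<times> L) (exp_prod ?Bs)"
    by (intro continuous_on_exp_prod compact_Times compact_Icc L) auto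
  then have "continuous_on ({0..1} \<times> L) ?h"
    unfolding vector_matrix_mult_def by (intro continuous_intros)
  moreover have nz: "?h y \<noteq> 0" for y
    by (rule vector_exp_prod_nonzero) (simp add: axis_eq_0_iff)
  ultimately have cont: "continuous_map (top_of_set ({0..1} \<times> L)) (top_of_set (- {0})) ?h"
    by (simp add: continuous_map_in_subtopology nz Pi_iff)
  have h0: "?h (0, x) = axis i 1" for x
  proof -
    have "exp_prod ?Bs (0, x) = mat 1"
      by (induction Bs) (simp_all add: mat_exp_square_zero)
    then show ?thesis by simp
  qed
  have h1: "?h (1, x) = f x" if "x \<in> L" for x
    using exp_prod_cong[of Bs "\<lambda>B y. fst y *\<^sub>R B (snd y)" "(1, x)" x] eq[OF that] by simp
  have "\<exists>h. continuous_map (top_of_set ({0..1::real} \<times> L)) (top_of_set (- {0})) h \<and>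
      (\<forall>x\<in>L. h (0, x) = axis i 1) \<and> (\<forall>x\<in>L. h (1, x) = f x)"
    by (rule exI[of _ ?h]) (intro conjI ballI cont h0 h1)
  then show ?thesis
    by (subst homotopic_with) simp_all
qed

section \<open>The topology of uniform convergence\<close>

text \<open>Trades balls of the supremum metric for pointwise bounds, the form in which all later
  estimates are made.\<close>

lemma openin_C_top:
  fixes L :: "'x::topological_space set" and S :: "('x \<Rightarrow> 'b::metric_space) set"
  shows "openin (C_top L) S \<longleftrightarrow> S \<subseteq> C_fun L \<and>
    (\<forall>f\<in>S. \<exists>e>0. \<forall>f'\<in>C_fun L. (\<forall>x\<in>L. dist (f x) (f' x) < e) \<longrightarrow> f' \<in> S)"
proof -
  interpret M: Metric_space "C_fun L :: ('x \<Rightarrow> 'b) set" "mdist (C_metric L)"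
    unfolding C_fun_def by (rule Metric_space_mspace_mdist)
  have near: "(\<exists>r>0. M.mball f r \<subseteq> S) \<longleftrightarrow>
      (\<exists>e>0. \<forall>f'\<in>C_fun L. (\<forall>x\<in>L. dist (f x) (f' x) < e) \<longrightarrow> f' \<in> S)"
    if f: "f \<in> C_fun L" for f
  proof safe
    fix r :: real assume r: "r > 0" "M.mball f r \<subseteq> S"
    \<comment> \<open>The radius is halved because a strict pointwise bound gives only a weak bound
      on the supremum.\<close>
    have "f' \<in> S" if f': "f' \<in> C_fun L" and d: "\<forall>x\<in>L. dist (f x) (f' x) < r / 2" for f'
    proof -
      have "mdist (C_metric L) f f' \<le> r / 2"
        using r d by (intro mdist_cfunspace_le) (auto simp: less_imp_le)
      then show ?thesis using r f f' by (auto simp: M.mball_def)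
    qed
    then show "\<exists>e>0. \<forall>f'\<in>C_fun L. (\<forall>x\<in>L. dist (f x) (f' x) < e) \<longrightarrow> f' \<in> S"
      using r by (metis half_gt_zero)
  next
    fix e :: real assume e: "e > 0"
      and S: "\<forall>f'\<in>C_fun L. (\<forall>x\<in>L. dist (f x) (f' x) < e) \<longrightarrow> f' \<in> S"
    have "f' \<in> S" if f': "f' \<in> M.mball f (e / 2)" for f'
    proof -
      have m: "f' \<in> C_fun L" "mdist (C_metric L) f f' \<le> e / 2"
        using f' by (auto simp: M.mball_def)
      have "dist (f x) (f' x) \<le> e / 2" if "x \<in> L" for x
        using mdist_cfunspace_imp_mdist_le[of f "top_of_set L" euclidean_metric f' "e / 2" x] m f that
        by (simp only: C_fun_def mdist_euclidean_metric topspace_euclidean_subtopology)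
      then have "\<forall>x\<in>L. dist (f x) (f' x) < e" using e by force
      then show ?thesis using S m(1) by blast
    qed
    then show "\<exists>r>0. M.mball f r \<subseteq> S" using e by (meson half_gt_zero subsetI)
  qed
  have "C_top L = M.mtopology"
    by (simp add: C_top_def mtopology_of_def C_fun_def)
  then have "openin (C_top L) S \<longleftrightarrow> S \<subseteq> C_fun L \<and> (\<forall>f\<in>S. \<exists>r>0. M.mball f r \<subseteq> S)"
    by (simp only: M.openin_mtopology Ball_def)
  also have "\<dots> \<longleftrightarrow> S \<subseteq> C_fun L \<and>
    (\<forall>f\<in>S. \<exists>e>0. \<forall>f'\<in>C_fun L. (\<forall>x\<in>L. dist (f x) (f' x) < e) \<longrightarrow> f' \<in> S)"
    by (intro conj_cong ball_cong refl near) blast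
  finally show ?thesis .
qed

text \<open>On the compact set \<open>{0..1} \<times> L\<close> the map \<open>h\<close> is
  uniformly continuous, so nearby parameters give slices that are close uniformly in
  \<open>x\<close>.\<close>

lemma pathin_C_top:
  fixes L :: "'x::metric_space set" and h :: "real \<times> 'x \<Rightarrow> 'b::metric_space"
  assumes L: "compact L" and h: "continuous_on ({0..1} \<times> L) h"
  shows "pathin (C_top L) (\<lambda>t. \<lambda>x\<in>L. h (t, x))"
  unfolding pathin_def continuous_map_def
proof (intro conjI allI impI)
  let ?p = "\<lambda>t. \<lambda>x\<in>L. h (t, x)"
  have p: "?p t \<in> C_fun L" if "t \<in> {0..1}" for t
  proof -
    have "continuous_on L (\<lambda>x. h (t, x))"
      by (rule continuous_on_compose2[OF h]) (use that in \<open>auto intro!: continuous_intros\<close>)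
    then show ?thesis by (simp add: C_fun_iff[OF L])
  qed
  then show "?p \<in> topspace (top_of_set {0..1}) \<rightarrow> topspace (C_top L)"
    by simp
  fix S :: "('x \<Rightarrow> 'b) set" assume S: "openin (C_top L) S"
  have unif: "uniformly_continuous_on ({0..1} \<times> L) h"
    using L by (intro compact_uniformly_continuous h compact_Times compact_Icc)
  have "\<exists>d>0. \<forall>t'\<in>{0..1}. dist t' t < d \<longrightarrow> ?p t' \<in> S" if t: "t \<in> {0..1}" "?p t \<in> S" for t
  proof -
    obtain e where e: "e > 0" "\<And>f'. f' \<in> C_fun L \<Longrightarrow> (\<forall>x\<in>L. dist (?p t x) (f' x) < e) \<Longrightarrow> f' \<in> S"
      using S t unfolding openin_C_top by blast
    obtain d where d: "d > 0" "\<And>y y'. y \<in> {0..1} \<times> L \<Longrightarrow> y' \<in> {0..1} \<times> L \<Longrightarrow>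
        dist y' y < d \<Longrightarrow> dist (h y') (h y) < e"
      using unif e(1) unfolding uniformly_continuous_on_def by metis
    have "?p t' \<in> S" if "t' \<in> {0..1}" "dist t' t < d" for t'
    proof (intro e(2) p ballI)
      fix x assume x: "x \<in> L"
      have "dist (t, x) (t', x) < d"
        using that by (simp add: dist_Pair_Pair dist_commute)
      then show "dist (?p t x) (?p t' x) < e"
        using d(2)[of "(t', x)" "(t, x)"] that t(1) x by simp
    qed (rule that)
    then show ?thesis using d(1) by blast
  qed
  then show "openin (top_of_set {0..1}) {t \<in> topspace (top_of_set {0..1}). ?p t \<in> S}"
    by (auto simp: openin_euclidean_subtopology_iff simp del: restrict_apply)
qed


section \<open>The principal component\<close>

text \<open>
  The reals and the complex numbers, with the conjugation \<open>cj\<close> and a logarithm \<open>lg\<close> on the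
  unit ball around \<open>1\<close>.
\<close>

locale real_or_complex =
  fixes cj lg :: "'k::{real_normed_field, euclidean_space} \<Rightarrow> 'k"
  assumes continuous_cj: "continuous_on UNIV cj"
    and cj_mult: "cj z * z = of_real ((norm z)\<^sup>2)"
    and continuous_lg: "continuous_on (ball 1 1) lg"
    and exp_lg: "z \<in> ball 1 1 \<Longrightarrow> exp (lg z) = z"
begin

lemma continuous_on_cj [continuous_intros]:
  "continuous_on S f \<Longrightarrow> continuous_on S (\<lambda>x. cj (f x))"
  by (rule continuous_on_compose2[OF continuous_cj]) auto

lemma unimodular_iff:
  fixes f :: "'x::topological_space \<Rightarrow> 'k ^ 'm"
  assumes L: "compact L"
  shows "f \<in> unimodular L \<longleftrightarrow> f \<in> C_fun L \<and> (\<forall>x\<in>L. f x \<noteq> 0)"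
proof safe
  fix x assume f: "f \<in> unimodular L" "x \<in> L" "f x = 0"
  then obtain u :: "'x \<Rightarrow> 'k ^ 'm" where "(\<Sum>j\<in>UNIV. u x $ j * f x $ j) = 1"
    by (auto simp: unimodular_def)
  with f(3) show False by simp
next
  assume f: "f \<in> C_fun L" "\<forall>x\<in>L. f x \<noteq> 0"
  let ?s = "\<lambda>x. of_real ((norm (f x))\<^sup>2) :: 'k"
  \<comment> \<open>The conjugate tuple divided by the squared norm solves the Bezout equation, and
    it is continuous where \<open>f\<close> has no zero.\<close>
  define u where "u = (\<lambda>x\<in>L. \<chi> j. cj (f x $ j) / ?s x)"
  have c: "continuous_on L f" using f(1) by (simp add: C_fun_iff[OF L])
  have "continuous_on L (\<lambda>x. \<chi> j. cj (f x $ j) / ?s x)"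
    using f(2) by (intro continuous_intros c) auto
  then have "u \<in> C_fun L" by (simp add: u_def C_fun_iff[OF L])
  moreover have "(\<Sum>j\<in>UNIV. u x $ j * f x $ j) = 1" if x: "x \<in> L" for x
  proof -
    have "(\<Sum>j\<in>UNIV. u x $ j * f x $ j) = (\<Sum>j\<in>UNIV. cj (f x $ j) * f x $ j) / ?s x"
      using x by (simp add: u_def sum_divide_distrib)
    also have "(\<Sum>j\<in>UNIV. cj (f x $ j) * f x $ j) = ?s x"
      unfolding cj_mult norm_vec_def L2_set_def by (simp add: sum_nonneg)
    finally show ?thesis using f(2) x by simp
  qed
  ultimately show "f \<in> unimodular L" using f(1) by (auto simp: unimodular_def)
qed (simp add: unimodular_def)

lemma openin_unimodular:
  "compact L \<Longrightarrow> openin (C_top L) (unimodular L :: ('x::topological_space \<Rightarrow> 'k ^ 'm) set)"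
  unfolding openin_C_top
proof (intro conjI ballI)
  assume L: "compact L"
  show "unimodular L \<subseteq> (C_fun L :: ('x \<Rightarrow> 'k ^ 'm) set)"
    by (auto simp: unimodular_def)
  fix f :: "'x \<Rightarrow> 'k ^ 'm" assume "f \<in> unimodular L"
  then have f: "continuous_on L f" "\<And>x. x \<in> L \<Longrightarrow> f x \<noteq> 0"
    by (auto simp: unimodular_iff[OF L] C_fun_iff[OF L])
  have "0 \<notin> f ` L" using f(2) by force
  with compact_continuous_image[OF f(1) L] obtain e where e: "e > 0" "\<And>y. y \<in> f ` L \<Longrightarrow> e \<le> dist 0 y"
    by (metis separate_point_closed compact_imp_closed)
  have "f' \<in> unimodular L" if "f' \<in> C_fun L" "\<forall>x\<in>L. dist (f x) (f' x) < e" for f'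
  proof -
    have "f' x \<noteq> 0" if "x \<in> L" for x
      using e(2)[of "f x"] \<open>\<forall>x\<in>L. dist (f x) (f' x) < e\<close> that by (force simp: dist_commute)
    then show ?thesis using that by (simp add: unimodular_iff[OF L])
  qed
  then show "\<exists>e>0. \<forall>f'\<in>C_fun L. (\<forall>x\<in>L. dist (f x) (f' x) < e) \<longrightarrow> f' \<in> unimodular L"
    using e(1) by blast
qed

text \<open>
  If \<open>\<Sum>\<^sub>j u\<^sub>j f\<^sub>j = 1\<close> and \<open>s = \<Sum>\<^sub>j u\<^sub>j f'\<^sub>j\<close> is near \<open>1\<close>, then \<open>f' = s f + w\<close> where
  \<open>\<Sum>\<^sub>j u\<^sub>j w\<^sub>j = 0\<close>. The matrix \<open>(u\<^sub>i w\<^sub>j)\<close> has square zero, hence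
  \<open>f' = f exp(log(s) I) exp((u\<^sub>i w\<^sub>j / s))\<close>.
\<close>

lemma exp_orbit_step:
  fixes f f' u :: "'x::topological_space \<Rightarrow> 'k ^ 'n"
  assumes L: "compact L" and f: "f \<in> exp_orbit i L" and f': "f' \<in> C_fun L"
    and u: "continuous_on L u" "\<And>x. x \<in> L \<Longrightarrow> (\<Sum>j\<in>UNIV. u x $ j * f x $ j) = 1"
    and near: "\<And>x. x \<in> L \<Longrightarrow> norm (1 - (\<Sum>j\<in>UNIV. u x $ j * f' x $ j)) < 1"
  shows "f' \<in> exp_orbit i L"
proof -
  obtain Bs where Bs: "\<forall>B\<in>set Bs. continuous_on L B"
    and eq: "\<And>x. x \<in> L \<Longrightarrow> f x = axis i 1 v* exp_prod Bs x"
    using f by (auto simp: exp_orbit_def)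
  have cf: "continuous_on L f" "continuous_on L f'"
    using f f' exp_orbit_subset_C_fun[OF L, of i, where ?'k = 'k] by (auto simp: C_fun_iff[OF L] subset_iff)
  define s where "s x = (\<Sum>j\<in>UNIV. u x $ j * f' x $ j)" for x
  define w where "w x = f' x - s x *s f x" for x
  have s: "s x \<in> ball 1 1" if "x \<in> L" for x
    using near[OF that] by (simp add: s_def dist_norm)
  then have s0: "s x \<noteq> 0" if "x \<in> L" for x using that by force
  have cs: "continuous_on L s" unfolding s_def by (intro continuous_intros u cf)
  have cw: "continuous_on L (\<lambda>x. w x $ j)" for j
    unfolding w_def by (simp, intro continuous_intros cs cf)
  have uw: "(\<Sum>j\<in>UNIV. u x $ j * w x $ j) = 0" if "x \<in> L" for x
  proof -
    have "(\<Sum>j\<in>UNIV. u x $ j * w x $ j) = s x - s x * (\<Sum>j\<in>UNIV. u x $ j * f x $ j)"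
      by (simp add: w_def s_def[symmetric] right_diff_distrib sum_subtractf sum_distrib_left mult_ac)
        (simp add: s_def mult_ac)
    then show ?thesis using u(2)[OF that] by simp
  qed
  define B where "B x = (mat (lg (s x)) :: 'k ^ 'n ^ 'n)" for x
  define N where "N x = (\<chi> i j. u x $ i * w x $ j / s x)" for x
  have "continuous_on L (\<lambda>x. lg (s x))"
    by (rule continuous_on_compose2[OF continuous_lg cs]) (use s in blast)
  then have "continuous_on L (\<lambda>x. if a = b then lg (s x) else 0)" for a b :: 'n
    by (cases "a = b") simp_all
  then have cB: "continuous_on L B"
    unfolding B_def mat_def by (intro continuous_on_vec_lambda)
  have cN: "continuous_on L N"
    unfolding N_def by (intro continuous_on_vec_lambda continuous_intros cs u cw) (use s0 in auto)
  have "f x v* exp_prod [B, N] x = f' x" if x: "x \<in> L" for x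
  proof -
    have "N x ** N x = 0"
    proof -
      have "(\<Sum>k\<in>UNIV. N x $ a $ k * N x $ k $ b) = 0" for a b
      proof -
        have "(\<Sum>k\<in>UNIV. N x $ a $ k * N x $ k $ b)
            = (u x $ a * w x $ b / (s x * s x)) * (\<Sum>k\<in>UNIV. u x $ k * w x $ k)"
          unfolding sum_distrib_left by (rule sum.cong) (simp_all add: N_def)
        then show ?thesis by (simp add: uw[OF x])
      qed
      then show ?thesis by (simp add: matrix_matrix_mult_def vec_eq_iff)
    qed
    then have N: "mat_exp (N x) = mat 1 + N x" by (rule mat_exp_square_zero)
    have "mat_exp (B x) = mat (s x)"
      using exp_lg[OF s[OF x]] by (simp add: B_def mat_exp_mat)
    then have B: "f x v* mat_exp (B x) = s x *s f x"
      by (simp add: vec_eq_iff vector_matrix_mult_def mat_def mult.commute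
          if_distrib[of "\<lambda>z. _ * z"] cong: if_cong)
    have "(s x *s f x) v* N x = w x"
    proof -
      have "(\<Sum>a\<in>UNIV. (s x * f x $ a) * N x $ a $ b) = w x $ b * (\<Sum>a\<in>UNIV. u x $ a * f x $ a)" for b
        using s0[OF x] by (simp add: N_def sum_distrib_left mult_ac)
      then show ?thesis using u(2)[OF x] by (simp add: vec_eq_iff vector_matrix_mult_def)
    qed
    then have "f x v* mat_exp (B x) v* mat_exp (N x) = f' x"
      by (simp add: N B vector_matrix_mult_add_rdistrib w_def)
    then show ?thesis by (simp add: vector_matrix_mul_assoc)
  qed
  then have "f' x = axis i 1 v* exp_prod (Bs @ [B, N]) x" if "x \<in> L" for x
    using that eq by (simp only: exp_prod_append vector_matrix_mul_assoc[symmetric])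
  moreover have "\<forall>B'\<in>set (Bs @ [B, N]). continuous_on L B'" using Bs cB cN by simp
  moreover have "f' \<in> extensional L" using f' by (simp add: C_fun_iff[OF L])
  ultimately show ?thesis unfolding exp_orbit_def by blast
qed

text \<open>\<open>exp_orbit_step\<close> is applied in both directions between \<open>f\<close> and
  \<open>f'\<close>. The resulting equivalence makes the orbit open and also closed among the
  unimodular tuples.\<close>

lemma exp_orbit_locally_constant:
  fixes f :: "'x::topological_space \<Rightarrow> 'k ^ 'n"
  assumes L: "compact L" and f: "f \<in> unimodular L"
  shows "\<exists>e>0. \<forall>f'\<in>C_fun L. (\<forall>x\<in>L. dist (f x) (f' x) < e) \<longrightarrow>
    (f \<in> exp_orbit i L \<longleftrightarrow> f' \<in> exp_orbit i L)"
proof -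
  obtain u :: "'x \<Rightarrow> 'k ^ 'n" where u: "u \<in> C_fun L"
    and uf: "\<And>x. x \<in> L \<Longrightarrow> (\<Sum>j\<in>UNIV. u x $ j * f x $ j) = 1"
    using f by (auto simp: unimodular_def)
  have fC: "f \<in> C_fun L" using f by (simp add: unimodular_def)
  have cu: "continuous_on L u" using u by (simp add: C_fun_iff[OF L])
  obtain R where R: "R > 0" "\<And>x. x \<in> L \<Longrightarrow> norm (u x) \<le> R"
    using compact_imp_bounded[OF compact_continuous_image[OF cu L]]
    by (auto simp: bounded_pos)
  \<comment> \<open>Each of the \<open>CARD('n)\<close> summands of \<open>1 - s x\<close> is at
    most \<open>R * e\<close>, so their sum is at most 1/3. This leaves \<open>norm (s x)\<close> at
    least 2/3, as the reverse direction requires.\<close>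
  define e where "e = 1 / (3 * real CARD('n) * R)"
  have e: "e > 0" using R(1) by (simp add: e_def)
  show ?thesis
  proof (intro exI conjI ballI impI)
    show "e > 0" by (rule e)
    fix f' :: "'x \<Rightarrow> 'k ^ 'n"
    assume f': "f' \<in> C_fun L" and "\<forall>x\<in>L. dist (f x) (f' x) < e"
    then have d: "dist (f x) (f' x) < e" if "x \<in> L" for x using that by blast
    define s where "s x = (\<Sum>j\<in>UNIV. u x $ j * f' x $ j)" for x
    have s: "norm (1 - s x) \<le> 1 / 3" if x: "x \<in> L" for x
    proof -
      have "1 - s x = (\<Sum>j\<in>UNIV. u x $ j * (f x - f' x) $ j)"
        by (simp add: s_def uf[OF x, symmetric] right_diff_distrib sum_subtractf)
      also have "norm \<dots> \<le> (\<Sum>j\<in>(UNIV :: 'n set). R * e)"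
      proof (rule sum_norm_le)
        fix j
        have "norm (u x $ j) \<le> R"
          by (rule order_trans[OF Finite_Cartesian_Product.norm_nth_le R(2)[OF x]])
        moreover have "norm ((f x - f' x) $ j) \<le> e"
          using Finite_Cartesian_Product.norm_nth_le[of "f x - f' x" j] d[OF x] by (simp add: dist_norm)
        ultimately show "norm (u x $ j * (f x - f' x) $ j) \<le> R * e"
          using R(1) by (simp only: norm_mult) (intro mult_mono, auto)
      qed
      also have "\<dots> = 1 / 3" using R(1) by (simp add: e_def)
      finally show ?thesis .
    qed
    show "f \<in> exp_orbit i L \<longleftrightarrow> f' \<in> exp_orbit i L"
    proof
      assume "f \<in> exp_orbit i L"
      then show "f' \<in> exp_orbit i L"
      proof (rule exp_orbit_step[OF L _ f' cu uf])
        show "norm (1 - (\<Sum>j\<in>UNIV. u x $ j * f' x $ j)) < 1" if "x \<in> L" for x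
          using s[OF that] by (simp add: s_def)
      qed
    next
      assume fo: "f' \<in> exp_orbit i L"
      have n: "norm (s x) \<ge> 2 / 3" if "x \<in> L" for x
        using s[OF that] norm_triangle_ineq2[of 1 "1 - s x"] by simp
      then have s0: "s x \<noteq> 0" if "x \<in> L" for x using that by force
      have cs: "continuous_on L s"
        unfolding s_def using f' by (intro continuous_intros cu) (simp add: C_fun_iff[OF L])
      \<comment> \<open>Dividing by \<open>s\<close> turns \<open>u\<close> into a Bezout solution
        for \<open>f'\<close>. Its pairing with \<open>f\<close> is \<open>1 / s x\<close>, whose
        distance from 1 is at most (1/3) / (2/3) = 1/2.\<close>
      define u' where "u' x = (\<chi> j. u x $ j / s x)" for x
      have u's: "(\<Sum>j\<in>UNIV. u' x $ j * y $ j) = (\<Sum>j\<in>UNIV. u x $ j * y $ j) / s x" for x y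
        by (simp add: u'_def sum_divide_distrib)
      show "f \<in> exp_orbit i L"
      proof (rule exp_orbit_step[OF L fo fC])
        show "continuous_on L u'" unfolding u'_def by (intro continuous_intros cu cs) (use s0 in auto)
        show "(\<Sum>j\<in>UNIV. u' x $ j * f' x $ j) = 1" if "x \<in> L" for x
          using s0[OF that] by (simp add: u's s_def[symmetric])
        show "norm (1 - (\<Sum>j\<in>UNIV. u' x $ j * f x $ j)) < 1" if x: "x \<in> L" for x
        proof -
          have "1 - 1 / s x = - ((1 - s x) / s x)" using s0[OF x] by (simp add: field_simps)
          then have "norm (1 - 1 / s x) = norm (1 - s x) / norm (s x)"
            by (simp only: norm_minus_cancel norm_divide)
          also have "\<dots> < 1"
            using s[OF x] n[OF x] s0[OF x] by (simp add: divide_less_eq)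
          finally show ?thesis by (simp add: u's uf[OF x])
        qed
      qed
    qed
  qed
qed

text \<open>Read slice by slice, the homotopy is a path of nowhere vanishing maps from e_1 to
  \<open>f\<close>, that is, a path in the space of unimodular tuples.\<close>

lemma homotopic_imp_principal_component:
  fixes f :: "'x::metric_space \<Rightarrow> 'k ^ 'n"
  assumes L: "compact L" and f: "f \<in> C_fun L"
    and hom: "homotopic_with_canon (\<lambda>_. True) L (- {0}) (\<lambda>_. axis i 1) f"
  shows "f \<in> principal_component i L"
proof -
  let ?X = "subtopology (C_top L) (unimodular L :: ('x \<Rightarrow> 'k ^ 'n) set)"
  have "\<exists>h. continuous_map (top_of_set ({0..1::real} \<times> L)) (top_of_set (- {0})) h
      \<and> (\<forall>x. h (0, x) = axis i 1) \<and> (\<forall>x. h (1, x) = f x)"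
    using hom by (simp add: homotopic_with_def)
  then obtain h where h': "continuous_map (top_of_set ({0..1::real} \<times> L)) (top_of_set (- {0})) h
      \<and> (\<forall>x. h (0, x) = axis i 1) \<and> (\<forall>x. h (1, x) = f x)" ..
  have h: "continuous_on ({0..1} \<times> L) h" "h \<in> ({0..1} \<times> L) \<rightarrow> - {0}"
    and h0: "h (0, x) = axis i 1" and h1: "h (1, x) = f x" for x
    using h' by (simp_all add: continuous_map_in_subtopology)
  let ?p = "\<lambda>t. \<lambda>x\<in>L. h (t, x)"
  have path: "pathin (C_top L) ?p" by (rule pathin_C_top[OF L h(1)])
  have "?p t \<in> unimodular L" if "t \<in> {0..1}" for t
  proof -
    have "?p t \<in> C_fun L"
      using path that by (auto simp: pathin_def continuous_map_def)
    then show ?thesis using h(2) that by (auto simp: unimodular_iff[OF L] Pi_iff)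
  qed
  then have "pathin ?X ?p"
    using path by (auto simp: pathin_def continuous_map_in_subtopology)
  moreover have "?p 0 = unit_tuple i L" "?p 1 = f"
    using f by (auto simp: h0 h1 unit_tuple_def C_fun_iff[OF L] extensional_restrict)
  ultimately have "path_component_of ?X (unit_tuple i L) f"
    unfolding path_component_of_def by blast
  then show ?thesis
    by (simp add: principal_component_def path_imp_connected_component_of)
qed

lemma principal_component_eq:
  fixes L :: "'x::metric_space set"
  assumes L: "compact L"
  shows "principal_component i L = (exp_orbit i L :: ('x \<Rightarrow> 'k ^ 'n) set)"
proof
  let ?U = "unimodular L :: ('x \<Rightarrow> 'k ^ 'n) set"
  let ?X = "subtopology (C_top L) ?U"
  let ?E = "exp_orbit i L :: ('x \<Rightarrow> 'k ^ 'n) set"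
  show "?E \<subseteq> principal_component i L"
    using exp_orbit_homotopic[OF L] exp_orbit_subset_C_fun[OF L]
    by (blast intro: homotopic_imp_principal_component[OF L])
  have EU: "?E \<subseteq> ?U"
    using exp_orbit_subset_C_fun[OF L] exp_orbit_nonzero by (force simp: unimodular_iff[OF L])
  have UC: "?U \<subseteq> C_fun L" by (auto simp: unimodular_def)
  have U: "openin (C_top L) ?U" by (rule openin_unimodular[OF L])
  have "openin (C_top L) ?E"
    unfolding openin_C_top
  proof (intro conjI ballI)
    fix f :: "'x \<Rightarrow> 'k ^ 'n" assume f: "f \<in> ?E"
    then have "f \<in> ?U" using EU by blast
    from exp_orbit_locally_constant[OF L this, of i] show "\<exists>e>0. \<forall>f'\<in>C_fun L. (\<forall>x\<in>L. dist (f x) (f' x) < e) \<longrightarrow> f' \<in> ?E"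
      using f by blast
  qed (use EU UC in blast)
  then have oE: "openin ?X ?E"
    using EU U by (simp add: openin_open_subtopology)
  \<comment> \<open>Of the two radii below, \<open>e1\<close> keeps a perturbation off the orbit and
    \<open>e2\<close> keeps it unimodular.\<close>
  have "openin (C_top L) (?U - ?E)"
    unfolding openin_C_top
  proof (intro conjI ballI)
    fix f :: "'x \<Rightarrow> 'k ^ 'n" assume f: "f \<in> ?U - ?E"
    then have "f \<in> ?U" by blast
    from exp_orbit_locally_constant[OF L this, of i] obtain e1 where e1: "e1 > 0"
      "\<forall>f'\<in>C_fun L. (\<forall>x\<in>L. dist (f x) (f' x) < e1) \<longrightarrow> (f \<in> ?E \<longleftrightarrow> f' \<in> ?E)"
      by blast
    obtain e2 where e2: "e2 > 0" "\<forall>f'\<in>C_fun L. (\<forall>x\<in>L. dist (f x) (f' x) < e2) \<longrightarrow> f' \<in> ?U"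
      using U f unfolding openin_C_top by blast
    show "\<exists>e>0. \<forall>f'\<in>C_fun L. (\<forall>x\<in>L. dist (f x) (f' x) < e) \<longrightarrow> f' \<in> ?U - ?E"
    proof (intro exI conjI ballI impI)
      show "min e1 e2 > 0" using e1(1) e2(1) by simp
      fix f' assume "f' \<in> C_fun L" "\<forall>x\<in>L. dist (f x) (f' x) < min e1 e2"
      then show "f' \<in> ?U - ?E" using e1(2) e2(2) f by simp
    qed
  qed (use UC in blast)
  then have "openin ?X (?U - ?E)"
    using U by (simp add: openin_open_subtopology)
  then have "closedin ?X ?E"
    using EU UC by (simp add: closedin_def inf_absorb2)
  moreover have "unit_tuple i L \<in> ?E"
    by (auto simp: exp_orbit_def unit_tuple_def intro!: exI[of _ "[]"])
  ultimately have "T \<subseteq> ?E" if "connectedin ?X T" "unit_tuple i L \<in> T" for T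
    using connectedin_clopen_cases[OF that(1) _ oE] that(2) unfolding disjnt_def by blast
  then show "principal_component i L \<subseteq> ?E"
    unfolding principal_component_def connected_component_of_def by blast
qed

end

section \<open>Restriction and extension of orbit elements, and normalisation of homotopies\<close>

lemma exp_orbit_restrict:
  assumes "f \<in> exp_orbit i K" "Z \<subseteq> K"
  shows "restrict f Z \<in> exp_orbit i Z"
proof -
  obtain Bs where "\<forall>B\<in>set Bs. continuous_on K B" "\<forall>x\<in>K. f x = axis i 1 v* exp_prod Bs x"
    using assms(1) by (auto simp: exp_orbit_def)
  then have "\<forall>B\<in>set Bs. continuous_on Z B" "\<forall>x\<in>Z. restrict f Z x = axis i 1 v* exp_prod Bs x"
    using assms(2) by (auto intro: continuous_on_subset)
  then show ?thesis unfolding exp_orbit_def by auto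
qed

lemma closedin_zero_set:
  fixes g :: "'x::topological_space \<Rightarrow> 'b::{t1_space, zero}"
  shows "continuous_on K g \<Longrightarrow> closedin (top_of_set K) (zero_set K g)"
  unfolding zero_set_def by (rule continuous_closedin_preimage_constant)

lemma zero_set_subset: "zero_set K g \<subseteq> K"
  by (auto simp: zero_set_def)

lemma compact_zero_set:
  fixes g :: "'x::topological_space \<Rightarrow> 'b::{t1_space, zero}"
  shows "compact K \<Longrightarrow> continuous_on K g \<Longrightarrow> compact (zero_set K g)"
  using closedin_compact closedin_zero_set by blast

text \<open>It is the exponents that are extended, not \<open>f\<close>: an arbitrary extension of
  \<open>f\<close> could acquire zeros, whereas e_1 times a product of exponentials never
  vanishes.\<close>

lemma exp_orbit_extend:
  fixes f :: "'x::{metric_space, second_countable_topology} \<Rightarrow> 'k::{real_normed_field, euclidean_space} ^ 'n"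
  assumes f: "f \<in> exp_orbit i Z" and Z: "closedin (top_of_set K) Z"
  obtains F where "F \<in> exp_orbit i K" "\<And>x. x \<in> Z \<Longrightarrow> F x = f x"
proof -
  obtain Bs where c: "\<forall>B\<in>set Bs. continuous_on Z B"
    and eq: "\<forall>x\<in>Z. f x = axis i 1 v* exp_prod Bs x"
    using f by (auto simp: exp_orbit_def)
  have "\<exists>B'. continuous_on K B' \<and> (\<forall>x\<in>Z. B' x = B x)" if "B \<in> set Bs" for B
  proof -
    have "continuous_on Z B" using c that by blast
    from Dugundji[OF convex_UNIV UNIV_not_empty Z this subset_UNIV] show ?thesis by metis
  qed
  then obtain ext where ext: "\<And>B. B \<in> set Bs \<Longrightarrow> continuous_on K (ext B)"
    "\<And>B x. B \<in> set Bs \<Longrightarrow> x \<in> Z \<Longrightarrow> ext B x = B x"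
    by metis
  show ?thesis
  proof
    show "(\<lambda>x\<in>K. axis i 1 v* exp_prod (map ext Bs) x) \<in> exp_orbit i K"
      unfolding exp_orbit_def using ext(1) by (auto intro!: exI[of _ "map ext Bs"])
    show "(\<lambda>x\<in>K. axis i 1 v* exp_prod (map ext Bs) x) x = f x" if x: "x \<in> Z" for x
    proof -
      have "exp_prod (map ext Bs) x = exp_prod Bs x"
        by (rule exp_prod_cong) (simp add: ext(2) x)
      then show ?thesis using x eq closedin_imp_subset[OF Z] by auto
    qed
  qed
qed

text \<open>Moves homotopies from the punctured space to the unit sphere, the setting of Borsuk's
  theorem on essential maps.\<close>

lemma homotopic_normalize:
  fixes f g :: "'x::topological_space \<Rightarrow> 'b::real_normed_vector"
  assumes "homotopic_with_canon (\<lambda>_. True) S (- {0}) f g"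
  shows "homotopic_with_canon (\<lambda>_. True) S (sphere 0 1)
    (\<lambda>x. inverse (norm (f x)) *\<^sub>R f x) (\<lambda>x. inverse (norm (g x)) *\<^sub>R g x)"
proof -
  have c: "continuous_on (- {0}) (\<lambda>y :: 'b. inverse (norm y) *\<^sub>R y)"
    by (intro continuous_intros) auto
  have "(\<lambda>y :: 'b. inverse (norm y) *\<^sub>R y) \<in> - {0} \<rightarrow> sphere 0 1" by auto
  from homotopic_with_compose_continuous_left[where p = "\<lambda>_. True", OF assms c this]
  show ?thesis by (simp only: comp_def)
qed

lemma homotopic_normalized:
  fixes f :: "'x::topological_space \<Rightarrow> 'b::real_normed_vector"
  assumes f: "continuous_on S f" "\<And>x. x \<in> S \<Longrightarrow> f x \<noteq> 0"
  shows "homotopic_with_canon (\<lambda>_. True) S (- {0}) f (\<lambda>x. inverse (norm (f x)) *\<^sub>R f x)"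
proof (rule homotopic_with_linear)
  show "continuous_on S (\<lambda>x. inverse (norm (f x)) *\<^sub>R f x)"
    using f by (intro continuous_intros) auto
  fix x assume x: "x \<in> S"
  have "(1 - u) *\<^sub>R f x + u *\<^sub>R inverse (norm (f x)) *\<^sub>R f x \<noteq> 0" if u: "0 \<le> u" "u \<le> 1" for u
  proof -
    \<comment> \<open>Every point of the segment from \<open>f x\<close> to its normalisation is
      this positive multiple of \<open>f x\<close>.\<close>
    have "1 - u + u * inverse (norm (f x)) > 0"
    proof (cases "u = 1")
      case False
      then show ?thesis using u by (intro add_pos_nonneg) auto
    qed (use f(2)[OF x] in simp)
    then have "(1 - u + u * inverse (norm (f x))) *\<^sub>R f x \<noteq> 0" using f(2)[OF x] by simp
    then show ?thesis by (simp only: scaleR_add_left scaleR_scaleR not_False_eq_True)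
  qed
  then show "closed_segment (f x) (inverse (norm (f x)) *\<^sub>R f x) \<subseteq> - {0}"
    by (fastforce simp: closed_segment_def)
qed (rule f(1))


section \<open>Reducibility and holes\<close>

context real_or_complex
begin

text \<open>Translates the hypothesis on \<open>f\<close> in assertion (1) into the one in assertion
  (2).\<close>

lemma tuple_snoc_unimodular:
  fixes f :: "'x::topological_space \<Rightarrow> 'k ^ 'n"
  assumes K: "compact K" and f: "f \<in> C_fun K" and g: "g \<in> C_fun K"
  shows "tuple_snoc K f g \<in> unimodular K \<longleftrightarrow> zero_set K f \<inter> zero_set K g = {}"
proof -
  have "continuous_on K (\<lambda>x. case j of None \<Rightarrow> g x | Some l \<Rightarrow> f x $ l)" for j
    using f g by (cases j) (auto simp: C_fun_iff[OF K] intro!: continuous_intros)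
  then have "tuple_snoc K f g \<in> C_fun K"
    unfolding tuple_snoc_def C_fun_iff[OF K] by (auto intro!: continuous_on_vec_lambda)
  moreover have "tuple_snoc K f g x = 0 \<longleftrightarrow> f x = 0 \<and> g x = 0" if "x \<in> K" for x
    using that by (auto simp: tuple_snoc_def vec_eq_iff split_option_all)
  ultimately show ?thesis
    by (auto simp: unimodular_iff[OF K] zero_set_def)
qed

text \<open>On \<open>Z(g)\<close> the summand \<open>g h\<close> vanishes, so there
  \<open>f\<close> agrees with an element of the orbit over \<open>K\<close>, whose exponents may be
  restricted.\<close>

lemma reducible_imp_exp_orbit:
  fixes f :: "'x::metric_space \<Rightarrow> 'k ^ 'n"
  assumes K: "compact K" and red: "reducible_to_principal_component i K f g"
  shows "restrict f (zero_set K g) \<in> exp_orbit i (zero_set K g)"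
proof -
  let ?Z = "zero_set K g"
  obtain h where "(\<lambda>x\<in>K. f x + g x *s h x) \<in> exp_orbit i K"
    using red unfolding reducible_to_principal_component_def principal_component_eq[OF K] by blast
  from exp_orbit_restrict[OF this zero_set_subset]
  have "restrict (\<lambda>x\<in>K. f x + g x *s h x) ?Z \<in> exp_orbit i ?Z" .
  moreover have "restrict (\<lambda>x\<in>K. f x + g x *s h x) ?Z = restrict f ?Z"
    by (auto simp: restrict_def zero_set_def vec_eq_iff)
  ultimately show ?thesis by simp
qed

text \<open>
  If \<open>F\<close> extends \<open>f\<close> from \<open>Z(g)\<close>, then \<open>f + g h\<close> with \<open>h = (F - f) cj(g) / (\<bar>g\<bar>\<^sup>2 + \<eta>)\<close> is
  uniformly close to \<open>F\<close> for small \<open>\<eta> > 0\<close>, since \<open>F - f\<close> is small wherever \<open>g\<close> is.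
\<close>

lemma exp_orbit_imp_reducible:
  fixes f :: "'x::{metric_space, second_countable_topology} \<Rightarrow> 'k ^ 'n"
  assumes K: "compact K" and f: "f \<in> C_fun K" and g: "g \<in> C_fun K"
    and orbit: "restrict f (zero_set K g) \<in> exp_orbit i (zero_set K g)"
  shows "reducible_to_principal_component i K f g"
proof -
  let ?Z = "zero_set K g"
  have cf: "continuous_on K f" and cg: "continuous_on K g"
    using f g by (auto simp: C_fun_iff[OF K])
  obtain F where F: "F \<in> exp_orbit i K" and "\<And>x. x \<in> ?Z \<Longrightarrow> F x = restrict f ?Z x"
    using exp_orbit_extend[OF orbit closedin_zero_set[OF cg]] by blast
  then have Ff: "F x = f x" if "x \<in> ?Z" for x using that by simp
  have FC: "F \<in> C_fun K" using F exp_orbit_subset_C_fun[OF K] by blast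
  then have cF: "continuous_on K F" by (simp add: C_fun_iff[OF K])
  have "F \<in> unimodular K"
    using F FC exp_orbit_nonzero unimodular_iff[OF K] by blast
  from exp_orbit_locally_constant[OF K this, of i] F obtain e where e: "e > 0"
    and near: "\<And>f'. f' \<in> C_fun K \<Longrightarrow> \<forall>x\<in>K. dist (F x) (f' x) < e \<Longrightarrow> f' \<in> exp_orbit i K"
    by blast
  define D where "D x = norm (F x - f x)" for x
  have cD: "continuous_on K D" unfolding D_def by (intro continuous_intros cF cf)
  obtain M where M: "M > 0" "\<And>x. x \<in> K \<Longrightarrow> D x \<le> M"
    using compact_imp_bounded[OF compact_continuous_image[OF cD K]] by (force simp: bounded_pos)
  \<comment> \<open>Since \<open>F = f\<close> on \<open>Z(g)\<close>, the function \<open>g\<close>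
    has no zero on \<open>S\<close>; by compactness its squared modulus is bounded below there by
    some \<open>c > 0\<close>.\<close>
  define S where "S = {x \<in> K. e \<le> D x}"
  have "closedin (top_of_set K) S"
    using continuous_closedin_preimage[OF cD closed_atLeast[of e]]
    by (simp add: S_def vimage_def Int_def)
  then have S: "compact S" using K closedin_compact by blast
  have cN: "continuous_on S (\<lambda>x. (norm (g x))\<^sup>2)"
    by (intro continuous_intros continuous_on_subset[OF cg]) (auto simp: S_def)
  have "(norm (g x))\<^sup>2 \<noteq> 0" if "x \<in> S" for x
    using that Ff[of x] e by (auto simp: S_def D_def zero_set_def)
  then have "0 \<notin> (\<lambda>x. (norm (g x))\<^sup>2) ` S" by force
  from separate_point_closed[OF compact_imp_closed[OF compact_continuous_image[OF cN S]] this]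
  obtain c where c: "c > 0" "\<And>x. x \<in> S \<Longrightarrow> c \<le> (norm (g x))\<^sup>2"
    by auto
  \<comment> \<open>Chosen so that \<open>\<eta> / c * M = e / 2\<close>, which bounds the error on
    \<open>S\<close>. Off \<open>S\<close> the quotient of \<open>\<eta>\<close> by
    \<open>?q x\<close> is at most 1 and \<open>D x < e\<close> suffices.\<close>
  define \<eta> where "\<eta> = c * e / (2 * M)"
  have \<eta>: "\<eta> > 0" using c e M by (simp add: \<eta>_def)
  let ?q = "\<lambda>x. (norm (g x))\<^sup>2 + \<eta>"
  have q: "?q x > 0" for x using \<eta> by (simp add: add_nonneg_pos)
  then have q0: "of_real (?q x) \<noteq> (0 :: 'k)" for x
    unfolding of_real_eq_0_iff by (metis less_irrefl)
  define h where "h = (\<lambda>x\<in>K. (cj (g x) / of_real (?q x)) *s (F x - f x))"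
  have "continuous_on K (\<lambda>x. (cj (g x) / of_real (?q x)) *s (F x - f x))"
    unfolding vector_scalar_mult_def by (intro continuous_intros cg cF cf) (use q0 in blast)
  then have h: "h \<in> C_fun K" by (simp add: h_def C_fun_iff[OF K])
  let ?f' = "\<lambda>x\<in>K. f x + g x *s h x"
  have "continuous_on K (\<lambda>x. f x + g x *s h x)"
    using h unfolding vector_scalar_mult_def C_fun_iff[OF K] by (intro continuous_intros cf cg) auto
  then have "?f' \<in> C_fun K" by (simp add: C_fun_iff[OF K])
  moreover have "dist (F x) (?f' x) < e" if x: "x \<in> K" for x
  proof -
    define k where "k = cj (g x) / of_real (?q x)"
    have hx: "h x = k *s (F x - f x)"
      using x by (simp only: h_def k_def restrict_apply')
    have "1 - g x * k = (of_real (?q x) - cj (g x) * g x) / of_real (?q x)"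
      using q0[of x] by (simp add: k_def diff_divide_distrib mult.commute)
    also have "\<dots> = of_real (\<eta> / ?q x)" unfolding cj_mult by simp
    finally have k: "1 - g x * k = of_real (\<eta> / ?q x)" .
    have "(F x - ?f' x) $ j = ((\<eta> / ?q x) *\<^sub>R (F x - f x)) $ j" for j
    proof -
      have "(F x - ?f' x) $ j = (1 - g x * k) * (F x $ j - f x $ j)"
        using x by (simp add: hx algebra_simps)
      then show ?thesis
        by (simp only: k vector_scaleR_component vector_minus_component scaleR_conv_of_real[where 'a = 'k])
    qed
    then have "F x - ?f' x = (\<eta> / ?q x) *\<^sub>R (F x - f x)"
      unfolding vec_eq_iff by blast
    then have d: "dist (F x) (?f' x) = \<eta> / ?q x * D x"
      using q[of x] \<eta> by (simp add: dist_norm D_def)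
    show ?thesis
    proof (cases "x \<in> S")
      case True
      have "\<eta> / ?q x * D x \<le> \<eta> / c * M"
        using c(1) c(2)[OF True] \<eta> M(2)[OF x] q[of x]
        by (intro mult_mono divide_left_mono) (auto simp: D_def)
      also have "\<dots> = e / 2" using c M by (simp add: \<eta>_def)
      finally show ?thesis unfolding d using e by linarith
    next
      case False
      have "\<eta> / ?q x * D x \<le> 1 * D x"
        using q[of x] by (intro mult_right_mono) (auto simp: D_def)
      moreover have "D x < e" using False x by (simp add: S_def)
      ultimately show ?thesis unfolding d by linarith
    qed
  qed
  ultimately have "?f' \<in> exp_orbit i K" using near by blast
  then show ?thesis
    unfolding reducible_to_principal_component_def principal_component_eq[OF K] using h by blast
qed

text \<open>The two assertions are equivalent for each \<open>f\<close> separately, since both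
  amount to \<open>restrict f Z\<close> lying in the orbit over \<open>Z\<close>.\<close>

lemma reducible_iff_exp_prod:
  fixes g :: "'x::{metric_space, second_countable_topology} \<Rightarrow> 'k" and i :: "'n::finite"
  assumes K: "compact K" and g: "g \<in> C_fun K"
  defines "Z \<equiv> zero_set K g"
  shows "(\<forall>f \<in> (C_fun K :: ('x \<Rightarrow> 'k ^ 'n) set).
        tuple_snoc K f g \<in> unimodular K \<longrightarrow> reducible_to_principal_component i K f g) \<longleftrightarrow>
      (\<forall>f \<in> (C_fun K :: ('x \<Rightarrow> 'k ^ 'n) set). zero_set K f \<inter> Z = {} \<longrightarrow>
        (\<exists>Bs. set Bs \<subseteq> C_fun Z \<and>
          restrict f Z = tuple_mult Z (unit_tuple i Z) (mat_fun_exp_prod Z Bs)))"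
proof -
  have Z: "compact Z"
    using g unfolding Z_def by (intro compact_zero_set K) (simp add: C_fun_iff[OF K])
  have "(tuple_snoc K f g \<in> unimodular K \<longrightarrow> reducible_to_principal_component i K f g) \<longleftrightarrow>
      (zero_set K f \<inter> Z = {} \<longrightarrow> restrict f Z \<in> exp_orbit i Z)"
    if "f \<in> C_fun K" for f :: "'x \<Rightarrow> 'k ^ 'n"
    using reducible_imp_exp_orbit[OF K, of i f g] exp_orbit_imp_reducible[OF K that g, of i]
    unfolding Z_def tuple_snoc_unimodular[OF K that g] by blast
  then show ?thesis unfolding exp_orbit_iff[OF Z] by (intro ball_cong refl)
qed

text \<open>For a hole \<open>H\<close> of \<open>Z\<close> and \<open>a \<in> H\<close>, the map \<open>x - a\<close> is essential on \<open>Z\<close>.\<close>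

lemma exp_prod_imp_no_holes:
  fixes i :: "'n::finite" and K Z :: "('k ^ 'n) set"
  assumes K: "compact K" and Z: "compact Z" "Z \<subseteq> K"
    and exp: "\<forall>f \<in> (C_fun K :: ('k ^ 'n \<Rightarrow> 'k ^ 'n) set). zero_set K f \<inter> Z = {} \<longrightarrow>
      (\<exists>Bs. set Bs \<subseteq> C_fun Z \<and>
        restrict f Z = tuple_mult Z (unit_tuple i Z) (mat_fun_exp_prod Z Bs))"
  shows "holes Z = {}"
proof (rule ccontr)
  assume "holes Z \<noteq> {}"
  then obtain H where H: "H \<in> components (- Z)" "bounded H" by (auto simp: holes_def)
  then obtain a where a: "a \<notin> Z" "H = connected_component_set (- Z) a"
    by (auto simp: components_def)
  \<comment> \<open>The only possible zero of this map is \<open>a\<close>, which lies outside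
    \<open>Z\<close>, so it is admissible in assertion (2).\<close>
  let ?f = "\<lambda>x\<in>K. x - a"
  have "?f \<in> C_fun K" by (simp add: C_fun_iff[OF K] continuous_on_diff)
  moreover have "zero_set K ?f \<inter> Z = {}" using a(1) by (auto simp: zero_set_def)
  ultimately have "restrict ?f Z \<in> exp_orbit i Z"
    using exp unfolding exp_orbit_iff[OF Z(1)] by blast
  from homotopic_normalize[OF exp_orbit_homotopic[OF Z(1) this]]
  have "homotopic_with_canon (\<lambda>_. True) Z (sphere 0 1)
      (\<lambda>x. inverse (norm (restrict ?f Z x)) *\<^sub>R restrict ?f Z x)
      (\<lambda>_. inverse (norm (axis i (1 :: 'k))) *\<^sub>R axis i 1)"
    by (rule homotopic_with_symD)
  then have "homotopic_with_canon (\<lambda>_. True) Z (sphere 0 1)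
      (\<lambda>x. inverse (norm (x - a)) *\<^sub>R (x - a)) (\<lambda>_. inverse (norm (axis i (1 :: 'k))) *\<^sub>R axis i 1)"
    by (rule homotopic_with_eq) (use Z(2) in auto)
  then show False
    using Borsuk_map_essential_bounded_component[OF Z(1) a(1)] H(2) a(2) by blast
qed

text \<open>On \<open>Z\<close>, \<open>f\<close> is deformed to its normalisation, then by Borsuk's
  separation theorem to a constant \<open>c\<close>, and finally to e_1 along a path from
  \<open>c\<close> that avoids 0. The last deformation uses that the punctured space is path
  connected in real dimension at least 2.\<close>

lemma no_holes_imp_exp_prod:
  fixes i :: "'n::finite" and K Z :: "('k ^ 'n) set" and f :: "'k ^ 'n \<Rightarrow> 'k ^ 'n"
  assumes dim: "DIM('k ^ 'n) \<ge> 2" and K: "compact K" and Z: "compact Z" "Z \<subseteq> K"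
    and holes: "holes Z = {}" and f: "f \<in> C_fun K" "zero_set K f \<inter> Z = {}"
  shows "\<exists>Bs. set Bs \<subseteq> C_fun Z \<and>
    restrict f Z = tuple_mult Z (unit_tuple i Z) (mat_fun_exp_prod Z Bs)"
proof -
  have cf: "continuous_on Z f"
    using f(1) Z(2) by (auto simp: C_fun_iff[OF K] intro: continuous_on_subset)
  have nz: "f x \<noteq> 0" if "x \<in> Z" for x
    using f(2) that Z(2) by (auto simp: zero_set_def)
  let ?s = "\<lambda>x. inverse (norm (f x)) *\<^sub>R f x"
  have cs: "continuous_on Z ?s" using nz by (intro continuous_intros cf) auto
  have "\<forall>c\<in>components (- Z). \<not> bounded c" using holes by (auto simp: holes_def)
  moreover have s: "?s \<in> Z \<rightarrow> sphere 0 1" using nz by auto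
  ultimately obtain c where "homotopic_with_canon (\<lambda>_. True) Z (sphere 0 1) ?s (\<lambda>_. c)"
    using Borsuk_separation_theorem_gen[OF Z(1)] cs by blast
  then have sc: "homotopic_with_canon (\<lambda>_. True) Z (- {0}) ?s (\<lambda>_. c)"
    by (rule homotopic_with_subset_right) auto
  have "homotopic_with_canon (\<lambda>_. True) Z (- {0}) (\<lambda>_. c) (\<lambda>_. axis i 1)"
  \<comment> \<open>For empty \<open>Z\<close> nothing is known about \<open>c\<close>, which could
    be 0; any two maps on the empty set are homotopic.\<close>
  proof (cases "Z = {}")
    case False
    then have "c \<noteq> 0"
      using homotopic_with_imp_subset2[OF sc] by auto
    then have "path_component (- {0}) c (axis i 1)"
      using path_connected_punctured_universe[OF dim, of 0]
      by (simp add: path_connected_component axis_eq_0_iff)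
    then show ?thesis by (simp add: homotopic_constant_maps)
  qed (simp only: homotopic_with_canon_on_empty)
  with homotopic_normalized[OF cf nz] sc
  have "homotopic_with_canon (\<lambda>_. True) Z (- {0}) f (\<lambda>_. axis i 1)"
    by (meson homotopic_with_trans)
  then have "homotopic_with_canon (\<lambda>_. True) Z (- {0}) (\<lambda>_. axis i 1) (restrict f Z)"
    by (subst homotopic_with_sym) (rule homotopic_with_eq, auto)
  moreover have "restrict f Z \<in> C_fun Z" using cf by (simp add: C_fun_iff[OF Z(1)])
  ultimately have "restrict f Z \<in> exp_orbit i Z"
    using homotopic_imp_principal_component[OF Z(1)] principal_component_eq[OF Z(1)] by blast
  then show ?thesis by (simp only: exp_orbit_iff[OF Z(1)])
qed

end

section \<open>The two scalar fields and the theorem\<close>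

lemma real_or_complex_real: "real_or_complex (\<lambda>x :: real. x) ln"
proof
  show "continuous_on (ball 1 1) (ln :: real \<Rightarrow> real)"
    by (intro continuous_on_ln continuous_on_id) (auto simp: dist_real_def)
qed (auto simp: power2_eq_square dist_real_def)

lemma real_or_complex_complex: "real_or_complex cnj Ln"
proof
  \<comment> \<open>The ball lies in the right half-plane, away from the branch cut of
    \<open>Ln\<close>.\<close>
  have pos: "Re z > 0" if "z \<in> ball 1 1" for z
    using that abs_Re_le_cmod[of "1 - z"] by (simp add: dist_norm)
  show "continuous_on (ball 1 1) Ln"
    by (rule continuous_on_Ln) (use pos in \<open>force simp: complex_nonpos_Reals_iff\<close>)
  show "exp (Ln z) = z" if "z \<in> ball 1 1" for z
    using pos[OF that] by (intro exp_Ln) auto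
  show "cnj z * z = of_real ((norm z)\<^sup>2)" for z
    by (simp only: complex_norm_square mult.commute)
qed (intro continuous_intros)

text \<open>Over the reals, (3) implies (2) only from \<open>CARD('n) = 2\<close> on. On the real
  line take \<open>K = {0}\<close>, \<open>g = 0\<close> and \<open>f = -1\<close>:
  \<open>Z(g)\<close> has no holes, but products of exponentials are positive, so \<open>f\<close>
  is not of the required form.\<close>

theorem theorem5p7:
  "(\<forall>(K :: (complex ^ 'n) set) (g :: complex ^ 'n \<Rightarrow> complex) (i :: 'n).
      compact K \<longrightarrow> g \<in> C_fun K \<longrightarrow>
      (let Z = zero_set K g;
           assertion1 = (\<forall>f \<in> (C_fun K :: (complex ^ 'n \<Rightarrow> complex ^ 'n) set).
                           tuple_snoc K f g \<in> unimodular K \<longrightarrow>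
                           reducible_to_principal_component i K f g);
           assertion2 = (\<forall>f \<in> (C_fun K :: (complex ^ 'n \<Rightarrow> complex ^ 'n) set).
                           zero_set K f \<inter> Z = {} \<longrightarrow>
                           (\<exists>Bs. set Bs \<subseteq> C_fun Z \<and>
                              restrict f Z = tuple_mult Z (unit_tuple i Z) (mat_fun_exp_prod Z Bs)));
           assertion3 = (holes Z = {})
       in (assertion1 \<longleftrightarrow> assertion2) \<and> (assertion2 \<longleftrightarrow> assertion3))) \<and>
   (\<forall>(K :: (real ^ 'n) set) (g :: real ^ 'n \<Rightarrow> real) (i :: 'n).
      compact K \<longrightarrow> g \<in> C_fun K \<longrightarrow>
      (let Z = zero_set K g;
           assertion1 = (\<forall>f \<in> (C_fun K :: (real ^ 'n \<Rightarrow> real ^ 'n) set).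
                           tuple_snoc K f g \<in> unimodular K \<longrightarrow>
                           reducible_to_principal_component i K f g);
           assertion2 = (\<forall>f \<in> (C_fun K :: (real ^ 'n \<Rightarrow> real ^ 'n) set).
                           zero_set K f \<inter> Z = {} \<longrightarrow>
                           (\<exists>Bs. set Bs \<subseteq> C_fun Z \<and>
                              restrict f Z = tuple_mult Z (unit_tuple i Z) (mat_fun_exp_prod Z Bs)));
           assertion3 = (holes Z = {})
       in (assertion1 \<longleftrightarrow> assertion2) \<and> (assertion2 \<longrightarrow> assertion3) \<and>
          (CARD('n) \<ge> 2 \<longrightarrow> assertion3 \<longrightarrow> assertion2)))"
proof (intro conjI allI impI, goal_cases)
  case (1 K g i)
  interpret real_or_complex cnj Ln by (rule real_or_complex_complex)
  have Z: "compact (zero_set K g)"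
    using 1 by (intro compact_zero_set) (simp_all add: C_fun_iff)
  \<comment> \<open>The real dimension is \<open>2 * CARD('n)\<close>, so one complex variable is
    enough.\<close>
  have dim: "DIM(complex ^ 'n) \<ge> 2" by (simp add: Suc_leI)
  show ?case
    unfolding Let_def
    by (rule conjI[OF reducible_iff_exp_prod[OF 1]], rule iffI,
        erule exp_prod_imp_no_holes[OF 1(1) Z zero_set_subset], intro ballI impI,
        erule no_holes_imp_exp_prod[OF dim 1(1) Z zero_set_subset])
next
  case (2 K g i)
  interpret real_or_complex "\<lambda>x :: real. x" ln by (rule real_or_complex_real)
  have Z: "compact (zero_set K g)"
    using 2 by (intro compact_zero_set) (simp_all add: C_fun_iff)
  have dim: "DIM(real ^ 'n) \<ge> 2" if "CARD('n) \<ge> 2" using that by simp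
  show ?case
    unfolding Let_def
    by (rule conjI[OF reducible_iff_exp_prod[OF 2]], intro conjI impI,
        erule exp_prod_imp_no_holes[OF 2(1) Z zero_set_subset], intro ballI impI,
        erule (1) no_holes_imp_exp_prod[OF dim 2(1) Z zero_set_subset])
qed

end
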